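(* The ideal $\mathrm{tr}(\mathscr N)$ is an HL ideal.
   Context: For $a\subseteq 2^{<\omega}$ let $\pi(a)=\{x\in2^\omega:\exists^\infty n\ (x\restriction n\in a)\}$. $\mathscr N$ is the ideal of Lebesgue null subsets of $2^\omega$ (with the standard product measure), and $\mathrm{tr}(\mathscr N)=\{a\subseteq2^{<\omega}:\pi(a)\in\mathscr N\}$, an ideal on the countable set $2^{<\omega}$. A tree is an initial subset of $(2^{<\omega},\subseteq)$ without maximal elements, perfect if every node has two incompatible extensions in it; $\mathbf S$ is the set of perfect trees; $p\restriction A=\{s\in p\cap2^n:n\in A\}$. An ideal $\mathcal I$ on a countable set (identified with $\omega$ via a bijection) is HL if for every $c:2^{<\omega}\to2$ there are $p\in\mathbf S$ and $A\in\mathcal I^+$ with $c$ constant on $p\restriction A$; equivalently $\mathcal I^+$ remains a reaping family after adding a Sacks real. *)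

theory Defs
  imports "HOL-Probability.Probability" "HOL-Library.Sublist"
begin

text \<open>
  The set \<open>2\<^sup><\<^sup>\<omega>\<close> is the type \<^typ>\<open>bool list\<close>, ordered by \<^const>\<open>prefix\<close>, and \<open>2\<^sup>\<omega>\<close> is the
  type \<^typ>\<open>nat \<Rightarrow> bool\<close>.
\<close>

definition restr :: "(nat \<Rightarrow> bool) \<Rightarrow> nat \<Rightarrow> bool list" where
  "restr x n = map x [0..<n]"

definition \<pi>_set :: "bool list set \<Rightarrow> (nat \<Rightarrow> bool) set" where
  "\<pi>_set a = {x. \<exists>\<^sub>\<infinity>n. restr x n \<in> a}"

definition cantor_measure :: "(nat \<Rightarrow> bool) measure" where
  "cantor_measure = (\<Pi>\<^sub>M i\<in>UNIV. uniform_count_measure (UNIV :: bool set))"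

text \<open>The completion makes every subset of a Borel null set a member.\<close>

definition null_ideal :: "(nat \<Rightarrow> bool) set set" where
  "null_ideal = null_sets (completion cantor_measure)"

definition trace_ideal :: "(nat \<Rightarrow> bool) set set \<Rightarrow> bool list set set" where
  "trace_ideal J = {a. \<pi>_set a \<in> J}"

text \<open>Ideals on an infinite set are proper and contain all finite sets.\<close>

definition is_ideal :: "'a set set \<Rightarrow> bool" where
  "is_ideal I \<longleftrightarrow>
     UNIV \<notin> I \<and>
     (\<forall>A. finite A \<longrightarrow> A \<in> I) \<and>
     (\<forall>A B. A \<in> I \<longrightarrow> B \<subseteq> A \<longrightarrow> B \<in> I) \<and>
     (\<forall>A B. A \<in> I \<longrightarrow> B \<in> I \<longrightarrow> A \<union> B \<in> I)"

definition positive_sets :: "'a set set \<Rightarrow> 'a set set" where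
  "positive_sets I = {A. A \<notin> I}"

definition is_tree :: "bool list set \<Rightarrow> bool" where
  "is_tree p \<longleftrightarrow>
     (\<forall>t\<in>p. \<forall>s. prefix s t \<longrightarrow> s \<in> p) \<and>
     (\<forall>s\<in>p. \<exists>t\<in>p. strict_prefix s t)"

text \<open>Nonemptiness is needed: the empty set satisfies the other conditions vacuously.\<close>

definition perfect_trees :: "bool list set set" where
  "perfect_trees = {p. p \<noteq> {} \<and> is_tree p \<and>
     (\<forall>s\<in>p. \<exists>t\<in>p. \<exists>u\<in>p. prefix s t \<and> prefix s u \<and> t \<parallel> u)}"

definition level_restr :: "bool list set \<Rightarrow> nat set \<Rightarrow> bool list set" where
  "level_restr p A = {s \<in> p. length s \<in> A}"

definition HL_on_nat :: "nat set set \<Rightarrow> bool" where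
  "HL_on_nat I \<longleftrightarrow>
     (\<forall>c :: bool list \<Rightarrow> bool. \<exists>p \<in> perfect_trees. \<exists>A \<in> positive_sets I.
        \<exists>i. \<forall>s \<in> level_restr p A. c s = i)"

text \<open>
  The property does not depend on the bijection with \<open>\<omega>\<close> used to transfer the ideal, so it is
  required for every bijection. That some bijection exists says that the underlying type is
  countably infinite.
\<close>

definition HL_ideal :: "'a set set \<Rightarrow> bool" where
  "HL_ideal I \<longleftrightarrow>
     is_ideal I \<and>
     (\<exists>e :: 'a \<Rightarrow> nat. bij e) \<and>
     (\<forall>e :: 'a \<Rightarrow> nat. bij e \<longrightarrow> HL_on_nat ((\<lambda>A. e ` A) ` I))"

end

theory Submission
  imports Defs
begin

text \<open>
  Let \<open>f t x = c (x \<restriction> e t)\<close>. Zorn's lemma yields an uncountable set \<open>S\<close> of reals and measurable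
  sets \<open>H x\<close>, \<open>x \<in> S\<close>, such that for all \<open>y\<close> and all finite \<open>F \<subseteq> S\<close> there are infinitely many \<open>n\<close>
  with \<open>f (y \<restriction> n) x \<longleftrightarrow> y \<in> H x\<close> for every \<open>x \<in> F\<close>. After passing to a majority colour, all
  \<open>H x\<close> have measure at least \<open>1/2\<close>. As the measure algebra is separable, all but countably many
  \<open>x \<in> S\<close> are condensation points of \<open>x \<mapsto> (x, H x)\<close>. A fusion through finite sets \<open>Q\<close> of
  condensation points, splitting each point at an arbitrarily small loss of the measure of
  \<open>\<Inter>x\<in>Q. H x\<close>, gives the perfect tree; since \<open>c\<close> at level \<open>e t\<close> depends only on \<open>x \<restriction> e t\<close>, the
  finitely many nodes \<open>t\<close> that cover most of this intersection at some stage keep their colour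
  at all later stages.
\<close>

section \<open>The measure on Cantor space\<close>

lemma space_cantor_measure [simp]: "space cantor_measure = UNIV"
  by (simp add: cantor_measure_def space_PiM space_uniform_count_measure)

lemma prob_space_cantor_measure: "prob_space cantor_measure"
  unfolding cantor_measure_def
  by (intro prob_space_PiM prob_space_uniform_count_measure) auto

interpretation cantor: prob_space cantor_measure
  by (rule prob_space_cantor_measure)

lemma measurable_coordinate: "(\<lambda>y. y i) \<in> measurable cantor_measure (count_space UNIV)"
proof -
  have "(\<lambda>y. y i) \<in> measurable cantor_measure (uniform_count_measure (UNIV :: bool set))"
    unfolding cantor_measure_def by (rule measurable_component_singleton) simp
  then show ?thesis
    by (simp add: measurable_def space_uniform_count_measure sets_uniform_count_measure)
qed

lemma length_restr [simp]: "length (restr x n) = n"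
  by (simp add: restr_def)

lemma restr_eq_iff: "restr x n = restr y n \<longleftrightarrow> (\<forall>i<n. x i = y i)"
  by (auto simp: restr_def)

lemma restr_eq_list_iff: "restr y n = s \<longleftrightarrow> length s = n \<and> (\<forall>i<n. y i = s ! i)"
  unfolding restr_def list_eq_iff_nth_eq by auto

lemma measurable_restr: "(\<lambda>y. restr y n) \<in> measurable cantor_measure (count_space UNIV)"
proof (rule measurable_count_space_eq_countable[THEN iffD2])
  show "countable (UNIV :: bool list set)" by simp
next
  have "(\<lambda>y. restr y n) -` {s} \<inter> space cantor_measure \<in> sets cantor_measure" for s
  proof -
    have eq: "(\<lambda>y. restr y n) -` {s} \<inter> space cantor_measure =
        {y \<in> space cantor_measure. length s = n \<and> (\<forall>i<n. y i = s ! i)}"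
      by (simp add: restr_eq_list_iff vimage_def)
    have [measurable]: "(\<lambda>y. y i) \<in> measurable cantor_measure (count_space UNIV)" for i
      by (rule measurable_coordinate)
    show ?thesis unfolding eq by measurable
  qed
  then show "(\<lambda>y. restr y n) \<in> space cantor_measure \<rightarrow> UNIV \<and>
      (\<forall>a\<in>UNIV. (\<lambda>y. restr y n) -` {a} \<inter> space cantor_measure \<in> sets cantor_measure)"
    by auto
qed

lemma pred_restr: "Measurable.pred cantor_measure (\<lambda>y. P (restr y n))"
  by (rule measurable_compose[OF measurable_restr]) simp

text \<open>This generator serves the induction on \<open>sigma_sets\<close> in
  \<open>clopen_approximation\<close>: each generating set is itself clopen.\<close>

lemma sets_cantor_measure:
  "sets cantor_measure = sigma_sets UNIV {{y. y i = b} | i b. True}"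
proof -
  have "sets cantor_measure =
      sigma_sets UNIV {{f\<in>UNIV \<rightarrow>\<^sub>E (UNIV::bool set). f i \<in> A} | i A. A \<in> sets (uniform_count_measure (UNIV::bool set))}"
    unfolding cantor_measure_def
    by (subst sets_PiM_single) (simp add: space_uniform_count_measure)
  also have "\<dots> = sigma_sets UNIV {{y. y i \<in> A} | i A. True}"
    by (simp add: sets_uniform_count_measure)
  also have "\<dots> = sigma_sets UNIV {{y. y i = b} | i b. True}" (is "sigma_sets _ ?L = sigma_sets _ ?R")
  proof (rule sigma_sets_eqI)
    fix a assume "a \<in> ?L"
    then obtain i A where a: "a = {y. y i \<in> A}" by auto
    have "a = (\<Union>b\<in>A. {y. y i = b})" unfolding a by auto
    moreover have "(\<Union>b\<in>A. {y. y i = b}) \<in> sigma_sets UNIV ?R"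
      by (rule sigma_sets_UNION) auto
    ultimately show "a \<in> sigma_sets UNIV ?R" by simp
  next
    fix a assume "a \<in> ?R"
    then obtain i b where a: "a = {y. y i = b}" by auto
    then have "a = {y. y i \<in> {b}}" by simp
    then show "a \<in> sigma_sets UNIV ?L" by blast
  qed
  finally show ?thesis .
qed

section \<open>Clopen sets and their density in the measure algebra\<close>

definition clopen_sets :: "(nat \<Rightarrow> bool) set set" where
  "clopen_sets = {{y. restr y n \<in> K} | n K. K \<subseteq> {s. length s = n}}"

text \<open>Restricting \<open>K\<close> to words of length \<open>n\<close> leaves only finitely
  many sets for each \<open>n\<close>.\<close>

lemma countable_clopen_sets: "countable clopen_sets"
proof -
  have fin: "finite {s :: bool list. length s = n}" for n
    using finite_lists_length_eq[of "UNIV :: bool set" n] by simp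
  have "clopen_sets = (\<Union>n. (\<lambda>K. {y. restr y n \<in> K}) ` Pow {s. length s = n})"
    by (auto simp: clopen_sets_def)
  also have "countable \<dots>"
    by (rule countable_UN) (simp_all add: fin countable_finite)
  finally show ?thesis .
qed

lemma clopen_setsI: "{y. P (restr y n)} \<in> clopen_sets"
  unfolding clopen_sets_def
  by (rule CollectI, rule exI[of _ n], rule exI[of _ "{s. length s = n \<and> P s}"]) auto

lemma clopen_sets_measurable: "K \<in> clopen_sets \<Longrightarrow> K \<in> sets cantor_measure"
  using pred_restr[of "\<lambda>s. s \<in> _"] by (auto simp: clopen_sets_def pred_def)

lemma clopen_sets_Compl: "K \<in> clopen_sets \<Longrightarrow> - K \<in> clopen_sets"
proof -
  assume "K \<in> clopen_sets"
  then obtain n L where "K = {y. restr y n \<in> L}" by (auto simp: clopen_sets_def)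
  then have "- K = {y. restr y n \<notin> L}" by auto
  then show ?thesis using clopen_setsI[of "\<lambda>s. s \<notin> L" n] by simp
qed

lemma clopen_sets_Un:
  assumes "K \<in> clopen_sets" "L \<in> clopen_sets"
  shows "K \<union> L \<in> clopen_sets"
proof -
  obtain n K' where K: "K = {y. restr y n \<in> K'}" using assms by (auto simp: clopen_sets_def)
  obtain m L' where L: "L = {y. restr y m \<in> L'}" using assms by (auto simp: clopen_sets_def)
  \<comment> \<open>Both conditions are read off the common level \<open>max n m\<close>.\<close>
  have take: "take k (restr y (max n m)) = restr y k" if "k \<le> max n m" for k y
    using that by (simp add: restr_def take_map)
  have "K \<union> L = {y. take n (restr y (max n m)) \<in> K' \<or> take m (restr y (max n m)) \<in> L'}"
    by (auto simp: K L take)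
  then show ?thesis
    using clopen_setsI[of "\<lambda>s. take n s \<in> K' \<or> take m s \<in> L'" "max n m"] by simp
qed

lemma clopen_sets_empty: "{} \<in> clopen_sets"
  using clopen_setsI[of "\<lambda>_. False" 0] by simp

text \<open>The approximable sets contain the generators and are closed under complements and
  countable unions. With \<open>countable_clopen_sets\<close> this is the separability of the
  measure algebra.\<close>

lemma clopen_approximation:
  assumes "B \<in> sets cantor_measure" and "\<epsilon> > 0"
  shows "\<exists>K\<in>clopen_sets. measure cantor_measure (sym_diff B K) < \<epsilon>"
proof -
  have "B \<in> sigma_sets UNIV {{y. y i = b} | i b. True}"
    using assms(1) by (simp add: sets_cantor_measure)
  then show ?thesis using assms(2)
  proof (induction arbitrary: \<epsilon> rule: sigma_sets.induct)
    case (Basic a)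
    then obtain i b where a: "a = {y. y i = b}" by auto
    have "a = {y. restr y (Suc i) ! i = b}" by (simp add: a restr_def del: upt_Suc)
    then have "a \<in> clopen_sets" using clopen_setsI[of "\<lambda>s. s ! i = b" "Suc i"] by simp
    then show ?case using Basic.prems by (intro bexI[of _ a]) auto
  next
    case Empty
    then show ?case using clopen_sets_empty by (intro bexI[of _ "{}"]) auto
  next
    case (Compl a)
    from Compl.IH[OF Compl.prems] obtain K
      where K: "K \<in> clopen_sets" "measure cantor_measure (sym_diff a K) < \<epsilon>" by auto
    have "sym_diff (UNIV - a) (- K) = sym_diff a K" by auto
    then show ?case using K clopen_sets_Compl by (intro bexI[of _ "- K"]) auto
  next
    case (Union a)
    have am[measurable]: "a i \<in> sets cantor_measure" for i
      using Union.hyps by (simp add: sets_cantor_measure)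
    \<comment> \<open>Some finite partial union misses less than half the tolerance; the other half
      is spent on approximating that finite union.\<close>
    have "(\<lambda>n. measure cantor_measure (\<Union>i<n. a i)) \<longlonglongrightarrow> measure cantor_measure (\<Union>n. \<Union>i<n. a i)"
      by (rule cantor.finite_Lim_measure_incseq) (force simp: incseq_def)+
    moreover have "(\<Union>n. \<Union>i<n. a i) = (\<Union>i. a i)" by auto
    ultimately have "\<forall>\<^sub>F n in sequentially.
        measure cantor_measure (\<Union>i. a i) - \<epsilon>/2 < measure cantor_measure (\<Union>i<n. a i)"
      using Union.prems by (intro order_tendstoD(1)) auto
    then obtain n where n: "measure cantor_measure (\<Union>i. a i) - \<epsilon>/2 < measure cantor_measure (\<Union>i<n. a i)"
      by (auto simp: eventually_sequentially)
    have "\<exists>K\<in>clopen_sets. measure cantor_measure (sym_diff (\<Union>i<n. a i) K) < \<delta>" if "\<delta> > 0" for n \<delta>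
      using that
    proof (induction n arbitrary: \<delta>)
      case 0
      then show ?case using clopen_sets_empty by (intro bexI[of _ "{}"]) auto
    next
      case (Suc n)
      then obtain K where K: "K \<in> clopen_sets" "measure cantor_measure (sym_diff (\<Union>i<n. a i) K) < \<delta>/2"
        using half_gt_zero by blast
      obtain L where L: "L \<in> clopen_sets" "measure cantor_measure (sym_diff (a n) L) < \<delta>/2"
        using Union.IH[of "\<delta>/2" n] Suc.prems by auto
      note [measurable] = clopen_sets_measurable[OF K(1)] clopen_sets_measurable[OF L(1)]
      have "measure cantor_measure (sym_diff (\<Union>i<Suc n. a i) (K \<union> L))
          \<le> measure cantor_measure (sym_diff (\<Union>i<n. a i) K \<union> sym_diff (a n) L)"
        by (rule cantor.finite_measure_mono) (auto simp: less_Suc_eq)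
      also have "\<dots> \<le> measure cantor_measure (sym_diff (\<Union>i<n. a i) K) + measure cantor_measure (sym_diff (a n) L)"
        by (rule measure_Un_le) auto
      finally show ?case using K L clopen_sets_Un by (intro bexI[of _ "K \<union> L"]) auto
    qed
    from this[of "\<epsilon>/2" n] Union.prems obtain K
      where K: "K \<in> clopen_sets" "measure cantor_measure (sym_diff (\<Union>i<n. a i) K) < \<epsilon>/2" by auto
    note [measurable] = clopen_sets_measurable[OF K(1)]
    have "measure cantor_measure (sym_diff (\<Union>i. a i) K)
        \<le> measure cantor_measure (((\<Union>i. a i) - (\<Union>i<n. a i)) \<union> sym_diff (\<Union>i<n. a i) K)"
      by (rule cantor.finite_measure_mono) auto
    also have "\<dots> \<le> measure cantor_measure ((\<Union>i. a i) - (\<Union>i<n. a i)) +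
        measure cantor_measure (sym_diff (\<Union>i<n. a i) K)"
      by (rule measure_Un_le) auto
    also have "measure cantor_measure ((\<Union>i. a i) - (\<Union>i<n. a i)) =
        measure cantor_measure (\<Union>i. a i) - measure cantor_measure (\<Union>i<n. a i)"
      by (rule cantor.finite_measure_Diff) auto
    finally show ?case using K n by (intro bexI[of _ K]) auto
  qed
qed

section \<open>Measurable ultrafilter limits\<close>

text \<open>
  An ultrafilter would decide all \<open>x\<close> at once, but need not do so measurably in \<open>y\<close>. A countable
  system of decisions can always be extended measurably to one more point, so a maximal system
  is uncountable.
\<close>

definition coherent_limits ::
    "'y measure \<Rightarrow> (nat \<Rightarrow> 'x \<Rightarrow> 'y \<Rightarrow> bool) \<Rightarrow> ('x \<times> 'y set) set \<Rightarrow> bool" where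
  "coherent_limits M b R \<longleftrightarrow> snd ` R \<subseteq> sets M \<and>
     (\<forall>F y. finite F \<longrightarrow> F \<subseteq> R \<longrightarrow> (\<exists>\<^sub>\<infinity>n. \<forall>(x, H)\<in>F. b n x y \<longleftrightarrow> y \<in> H))"

lemma coherent_limitsD:
  "coherent_limits M b R \<Longrightarrow> finite F \<Longrightarrow> F \<subseteq> R \<Longrightarrow> \<exists>\<^sub>\<infinity>n. \<forall>(x, H)\<in>F. b n x y \<longleftrightarrow> y \<in> H"
  by (simp add: coherent_limits_def)

text \<open>A point \<open>y\<close> is put into \<open>H\<close> when the value True at
  \<open>x\<close> is compatible with every finite part of \<open>R\<close>. Otherwise some finite
  part forces False, and then False is compatible with all of them. Countability of \<open>R\<close>
  makes \<open>H\<close> a countable intersection of measurable sets.\<close>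

lemma coherent_limits_extend:
  assumes b: "\<And>n x. Measurable.pred M (b n x)"
    and sp: "space M = UNIV"
    and R: "coherent_limits M b R" and cnt: "countable R"
  shows "\<exists>H. coherent_limits M b (insert (x, H) R)"
proof -
  define H where "H = {y. \<forall>F\<in>{F. finite F \<and> F \<subseteq> R}.
      \<exists>\<^sub>\<infinity>n. (\<forall>(x', H')\<in>F. b n x' y \<longleftrightarrow> y \<in> H') \<and> b n x y}"
  have cF: "countable {F. finite F \<and> F \<subseteq> R}"
    using countable_Collect_finite_subset[OF cnt] by (simp add: conj_commute)
  have pF: "Measurable.pred M (\<lambda>y. \<forall>(x', H')\<in>F. b n x' y \<longleftrightarrow> y \<in> H')" if "finite F" "F \<subseteq> R" for F n
  proof -
    have "Measurable.pred M (\<lambda>y. b n (fst z) y \<longleftrightarrow> y \<in> snd z)" if "z \<in> F" for z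
    proof -
      have [measurable]: "snd z \<in> sets M" using R that \<open>F \<subseteq> R\<close> by (auto simp: coherent_limits_def)
      note [measurable] = b
      show ?thesis by measurable
    qed
    then show ?thesis using that(1) by (auto simp: case_prod_beta intro!: pred_intros_finite)
  qed
  have "{y. \<exists>\<^sub>\<infinity>n. (\<forall>(x', H')\<in>F. b n x' y \<longleftrightarrow> y \<in> H') \<and> b n x y} \<in> sets M"
    if "finite F" "F \<subseteq> R" for F
  proof -
    have "Measurable.pred M (\<lambda>y. \<exists>\<^sub>\<infinity>n. (\<forall>(x', H')\<in>F. b n x' y \<longleftrightarrow> y \<in> H') \<and> b n x y)"
      unfolding INFM_nat
      by (intro pred_intros_countable pred_intros_logic pF b that) auto
    then show ?thesis by (simp add: pred_def sp)
  qed
  then have "(\<Inter>F\<in>{F. finite F \<and> F \<subseteq> R}.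
      {y. \<exists>\<^sub>\<infinity>n. (\<forall>(x', H')\<in>F. b n x' y \<longleftrightarrow> y \<in> H') \<and> b n x y}) \<in> sets M"
    using cF sets.top[of M] by (intro sets.countable_INT'') (auto simp: sp)
  moreover have "H = (\<Inter>F\<in>{F. finite F \<and> F \<subseteq> R}.
      {y. \<exists>\<^sub>\<infinity>n. (\<forall>(x', H')\<in>F. b n x' y \<longleftrightarrow> y \<in> H') \<and> b n x y})"
    by (auto simp: H_def)
  ultimately have H: "H \<in> sets M" by simp
  have "\<exists>\<^sub>\<infinity>n. \<forall>(x', H')\<in>F. b n x' y \<longleftrightarrow> y \<in> H'" if F: "finite F" "F \<subseteq> insert (x, H) R" for F y
  proof -
    define G where "G = F - {(x, H)}"
    have G: "finite G" "G \<subseteq> R" using F by (auto simp: G_def)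
    show ?thesis
    proof (cases "y \<in> H")
      case True
      then have "\<exists>\<^sub>\<infinity>n. (\<forall>(x', H')\<in>G. b n x' y \<longleftrightarrow> y \<in> H') \<and> b n x y"
        using G by (auto simp: H_def)
      then show ?thesis
        by (rule INFM_mono) (use True in \<open>auto simp: G_def\<close>)
    next
      case False
      then obtain E where E: "finite E" "E \<subseteq> R"
        and fin: "\<not> (\<exists>\<^sub>\<infinity>n. (\<forall>(x', H')\<in>E. b n x' y \<longleftrightarrow> y \<in> H') \<and> b n x y)"
        by (auto simp: H_def)
      \<comment> \<open>Infinitely many \<open>n\<close> meet the demands of
        \<open>E \<union> G\<close>, and all but finitely many of these give \<open>x\<close> the
        value False, as \<open>y \<notin> H\<close> asks.\<close>
      have "\<exists>\<^sub>\<infinity>n. \<forall>(x', H')\<in>E \<union> G. b n x' y \<longleftrightarrow> y \<in> H'"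
        by (rule coherent_limitsD[OF R]) (use E G in auto)
      moreover have "\<forall>\<^sub>\<infinity>n. \<not> ((\<forall>(x', H')\<in>E. b n x' y \<longleftrightarrow> y \<in> H') \<and> b n x y)"
        using fin by (simp add: not_INFM)
      ultimately have "\<exists>\<^sub>\<infinity>n. (\<forall>(x', H')\<in>E \<union> G. b n x' y \<longleftrightarrow> y \<in> H') \<and>
          \<not> ((\<forall>(x', H')\<in>E. b n x' y \<longleftrightarrow> y \<in> H') \<and> b n x y)"
        by (rule INFM_conjI)
      then show ?thesis
        by (rule INFM_mono) (use False in \<open>auto simp: G_def\<close>)
    qed
  qed
  then have "coherent_limits M b (insert (x, H) R)"
    using R H by (auto simp: coherent_limits_def)
  then show ?thesis ..
qed

text \<open>Coherence concerns finite subsets only, so it passes to unions of chains and Zorn's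
  lemma applies.\<close>

lemma uncountable_coherent_limits:
  fixes b :: "nat \<Rightarrow> 'x \<Rightarrow> 'y \<Rightarrow> bool"
  assumes b: "\<And>n x. Measurable.pred M (b n x)"
    and sp: "space M = UNIV"
    and unc: "uncountable (UNIV :: 'x set)"
  obtains S :: "'x set" and H where "uncountable S" and "\<And>x. x \<in> S \<Longrightarrow> H x \<in> sets M"
    and "\<And>F y. finite F \<Longrightarrow> F \<subseteq> S \<Longrightarrow> \<exists>\<^sub>\<infinity>n. \<forall>x\<in>F. b n x y \<longleftrightarrow> y \<in> H x"
proof -
  have "\<exists>R\<in>Collect (coherent_limits M b). \<forall>R'\<in>Collect (coherent_limits M b). R \<subseteq> R' \<longrightarrow> R' = R"
  proof (rule subset_Zorn_nonempty)
    have "coherent_limits M b {}" by (auto simp: coherent_limits_def)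
    then show "Collect (coherent_limits M b) \<noteq> {}" by blast
  next
    fix C assume C: "C \<noteq> {}" "subset.chain (Collect (coherent_limits M b)) C"
    then have coh: "coherent_limits M b R" if "R \<in> C" for R
      using that by (auto simp: subset.chain_def)
    have "\<exists>\<^sub>\<infinity>n. \<forall>(x, H)\<in>F. b n x y \<longleftrightarrow> y \<in> H" if F: "finite F" "F \<subseteq> \<Union>C" for F y
    proof -
      obtain R where "R \<in> C" "F \<subseteq> R"
        using finite_subset_Union_chain[OF F C] by blast
      then show ?thesis using coherent_limitsD[OF coh] F(1) by blast
    qed
    moreover have "snd ` \<Union>C \<subseteq> sets M" using coh by (force simp: coherent_limits_def)
    ultimately show "\<Union>C \<in> Collect (coherent_limits M b)"
      by (simp add: coherent_limits_def)
  qed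
  then obtain R where R: "coherent_limits M b R"
    and max: "\<And>R'. coherent_limits M b R' \<Longrightarrow> R \<subseteq> R' \<Longrightarrow> R' = R" by auto
  have unique: "H = H'" if "(x, H) \<in> R" "(x, H') \<in> R" for x H H'
  proof (rule set_eqI)
    fix y
    \<comment> \<open>A single \<open>n\<close> realises both values at \<open>y\<close>, so
      \<open>H\<close> and \<open>H'\<close> agree there; thus \<open>R\<close> is the graph of a
      function.\<close>
    have "\<exists>\<^sub>\<infinity>n. \<forall>(x, H)\<in>{(x, H), (x, H')}. b n x y \<longleftrightarrow> y \<in> H"
      by (rule coherent_limitsD[OF R]) (use that in auto)
    then obtain n where "\<forall>(x, H)\<in>{(x, H), (x, H')}. b n x y \<longleftrightarrow> y \<in> H"
      by (auto dest: INFM_EX)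
    then show "y \<in> H \<longleftrightarrow> y \<in> H'" by auto
  qed
  define S where "S = fst ` R"
  define H where "H x = (THE H. (x, H) \<in> R)" for x
  have HR: "(x, H x) \<in> R" if x: "x \<in> S" for x
  proof -
    obtain H' where H': "(x, H') \<in> R" using x by (auto simp: S_def)
    show ?thesis unfolding H_def by (rule theI[where P = "\<lambda>H. (x, H) \<in> R", OF H']) (use unique H' in blast)
  qed
  have "uncountable S"
  proof
    assume "countable S"
    have "R \<subseteq> (\<lambda>x. (x, H x)) ` S"
    proof
      fix z assume z: "z \<in> R"
      then have "fst z \<in> S" by (simp add: S_def)
      moreover have "z = (fst z, H (fst z))"
        using unique[of "fst z" "snd z" "H (fst z)"] HR[OF \<open>fst z \<in> S\<close>] z by (simp add: prod_eq_iff)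
      ultimately show "z \<in> (\<lambda>x. (x, H x)) ` S" by blast
    qed
    then have cR: "countable R" using \<open>countable S\<close> countable_subset by blast
    obtain x where x: "x \<notin> S" using unc \<open>countable S\<close> by (metis UNIV_eq_I)
    obtain K where "coherent_limits M b (insert (x, K) R)"
      using coherent_limits_extend[OF b sp R cR] by blast
    then have "insert (x, K) R = R" by (rule max) auto
    then show False using x by (force simp: S_def)
  qed
  moreover have "H x \<in> sets M" if "x \<in> S" for x
    using HR[OF that] R by (force simp: coherent_limits_def)
  moreover have "\<exists>\<^sub>\<infinity>n. \<forall>x\<in>F. b n x y \<longleftrightarrow> y \<in> H x" if "finite F" "F \<subseteq> S" for F y
  proof -
    have "(\<lambda>x. (x, H x)) ` F \<subseteq> R" using HR that by auto
    then have "\<exists>\<^sub>\<infinity>n. \<forall>(x, H)\<in>(\<lambda>x. (x, H x)) ` F. b n x y \<longleftrightarrow> y \<in> H"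
      by (intro coherent_limitsD[OF R]) (simp_all add: that(1))
    then show ?thesis by simp
  qed
  ultimately show ?thesis by (rule that)
qed

text \<open>One of \<open>H x\<close> and its complement has measure at least 1/2, and the same
  choice is right for uncountably many \<open>x\<close>. Complements correspond to the colour
  False.\<close>

lemma majority_color:
  fixes b :: "nat \<Rightarrow> 'x \<Rightarrow> (nat \<Rightarrow> bool) \<Rightarrow> bool"
  assumes b: "\<And>n x. Measurable.pred cantor_measure (b n x)"
    and unc: "uncountable (UNIV :: 'x set)"
  obtains S :: "'x set" and H i where "uncountable S" and "\<And>x. x \<in> S \<Longrightarrow> H x \<in> sets cantor_measure"
    and "\<And>x. x \<in> S \<Longrightarrow> measure cantor_measure (H x) \<ge> 1/2"
    and "\<And>F y. finite F \<Longrightarrow> F \<subseteq> S \<Longrightarrow> y \<in> (\<Inter>x\<in>F. H x) \<Longrightarrow> \<exists>\<^sub>\<infinity>n. \<forall>x\<in>F. b n x y = i"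
proof -
  obtain S :: "'x set" and H where S: "uncountable S" and H: "\<And>x. x \<in> S \<Longrightarrow> H x \<in> sets cantor_measure"
    and lim: "\<And>F y. finite F \<Longrightarrow> F \<subseteq> S \<Longrightarrow> \<exists>\<^sub>\<infinity>n. \<forall>x\<in>F. b n x y \<longleftrightarrow> y \<in> H x"
    by (rule uncountable_coherent_limits[where b = b, OF b space_cantor_measure unc]) (rule that)
  define T where "T = {x \<in> S. measure cantor_measure (H x) \<ge> 1/2}"
  have "uncountable T \<or> uncountable (S - T)"
    using S by (metis Un_Diff_cancel countable_Un countable_subset sup_ge2)
  then show ?thesis
  proof
    assume "uncountable T"
    then show ?thesis
    proof (rule that[of T H True])
      fix F y assume F: "finite F" "F \<subseteq> T" "y \<in> (\<Inter>x\<in>F. H x)"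
      then have "\<exists>\<^sub>\<infinity>n. \<forall>x\<in>F. b n x y \<longleftrightarrow> y \<in> H x" by (intro lim) (auto simp: T_def)
      then show "\<exists>\<^sub>\<infinity>n. \<forall>x\<in>F. b n x y = True" by (rule INFM_mono) (use F in auto)
    qed (auto simp: T_def H)
  next
    assume "uncountable (S - T)"
    then show ?thesis
    proof (rule that[of "S - T" "\<lambda>x. - H x" False])
      fix x assume "x \<in> S - T"
      then show "- H x \<in> sets cantor_measure" "1/2 \<le> measure cantor_measure (- H x)"
        using H[of x] cantor.prob_compl[of "H x"] sets.compl_sets[of "H x" cantor_measure]
        by (auto simp: T_def Compl_eq_Diff_UNIV)
    next
      fix F y assume F: "finite F" "F \<subseteq> S - T" "y \<in> (\<Inter>x\<in>F. - H x)"
      then have "\<exists>\<^sub>\<infinity>n. \<forall>x\<in>F. b n x y \<longleftrightarrow> y \<in> H x" by (intro lim) auto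
      then show "\<exists>\<^sub>\<infinity>n. \<forall>x\<in>F. b n x y = False" by (rule INFM_mono) (use F in auto)
    qed
  qed
qed

section \<open>Condensation points\<close>

text \<open>The pairs \<open>(x, H x)\<close> lie in a space with a countable base. Deleting every
  basic neighbourhood that contains only countably many points of \<open>S\<close> removes countably
  many points in all, so what remains is nonempty and has no isolated points.\<close>

lemma condensation_subset:
  assumes S: "uncountable S" and H: "\<And>x. x \<in> S \<Longrightarrow> H x \<in> sets cantor_measure"
  obtains T where "T \<subseteq> S" "T \<noteq> {}"
    and "\<And>x m \<epsilon>. x \<in> T \<Longrightarrow> \<epsilon> > 0 \<Longrightarrow>
      \<exists>x'\<in>T. x' \<noteq> x \<and> restr x' m = restr x m \<and> measure cantor_measure (H x - H x') < \<epsilon>"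
proof -
  \<comment> \<open>A basic neighbourhood: \<open>x\<close> extends \<open>s\<close>, and
    \<open>H x\<close> is within \<open>1 / real (Suc j)\<close> of the clopen set
    \<open>K\<close>.\<close>
  define C where "C = (\<lambda>(s, K, j::nat).
    {x \<in> S. restr x (length s) = s \<and> measure cantor_measure (sym_diff (H x) K) < 1 / real (Suc j)})"
  define I where "I = {z \<in> UNIV \<times> clopen_sets \<times> UNIV. countable (C z)}"
  define B where "B = (\<Union>z\<in>I. C z)"
  have "countable I" unfolding I_def
    by (rule countable_subset[of _ "UNIV \<times> clopen_sets \<times> UNIV"])
      (auto intro!: countable_SIGMA countable_clopen_sets)
  then have B: "countable B" unfolding B_def by (auto simp: I_def)
  show ?thesis
  proof (rule that[of "S - B"])
    show "S - B \<noteq> {}" using S B by (metis countable_subset Diff_eq_empty_iff)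
  next
    fix x m and \<epsilon> :: real assume x: "x \<in> S - B" and "\<epsilon> > 0"
    \<comment> \<open>Half of \<open>\<epsilon>\<close>, because \<open>H x\<close> and
      \<open>H x'\<close> are compared through the common set \<open>K\<close>.\<close>
    obtain j where j: "1 / real (Suc j) < \<epsilon> / 2"
      using reals_Archimedean[of "\<epsilon>/2"] \<open>\<epsilon> > 0\<close> by (auto simp: inverse_eq_divide)
    obtain K where K: "K \<in> clopen_sets" "measure cantor_measure (sym_diff (H x) K) < 1 / real (Suc j)"
      using clopen_approximation[OF H, of x "1 / real (Suc j)"] x by auto
    have xC: "x \<in> C (restr x m, K, j)" using x K by (auto simp: C_def)
    then have "uncountable (C (restr x m, K, j))" using x K by (auto simp: B_def I_def)
    \<comment> \<open>Inserting \<open>x\<close> secures \<open>x' \<noteq> x\<close>.\<close>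
    then have "\<not> C (restr x m, K, j) \<subseteq> insert x B" using B by (meson countable_insert countable_subset)
    then obtain x' where x': "x' \<in> C (restr x m, K, j)" "x' \<noteq> x" "x' \<notin> B" by auto
    then have xS: "x \<in> S" "x' \<in> S" using x by (auto simp: C_def)
    note [measurable] = clopen_sets_measurable[OF K(1)] H[OF xS(1)] H[OF xS(2)]
    have "measure cantor_measure (H x - H x')
        \<le> measure cantor_measure (sym_diff (H x) K \<union> sym_diff (H x') K)"
      by (rule cantor.finite_measure_mono) auto
    also have "\<dots> \<le> measure cantor_measure (sym_diff (H x) K) + measure cantor_measure (sym_diff (H x') K)"
      by (rule measure_Un_le) auto
    also have "\<dots> < \<epsilon>" using K x' j by (auto simp: C_def)
    finally show "\<exists>x'\<in>S - B. x' \<noteq> x \<and> restr x' m = restr x m \<and> measure cantor_measure (H x - H x') < \<epsilon>"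
      using x' xS by (intro bexI[of _ x']) (auto simp: C_def)
  qed auto
qed

section \<open>Fusion\<close>

definition cylinders :: "bool list set \<Rightarrow> (nat \<Rightarrow> bool) set" where
  "cylinders F = {y. \<exists>n. restr y n \<in> F}"

lemma cylinders_measurable [measurable]: "cylinders F \<in> sets cantor_measure"
proof -
  have "Measurable.pred cantor_measure (\<lambda>y. \<exists>n. restr y n \<in> F)"
    by (intro pred_intros_countable pred_restr)
  then show ?thesis by (simp add: pred_def cylinders_def)
qed

text \<open>The limsup of the sets \<open>cylinders (F k)\<close> has measure at least
  \<open>\<delta>\<close> by continuity from above. As the words in \<open>F k\<close> have length
  at least \<open>k\<close>, a point of the limsup meets the union of the \<open>F k\<close> at
  infinitely many levels.\<close>

lemma not_null_pi_set:
  assumes meas: "\<And>k. measure cantor_measure (cylinders (F k)) > \<delta>" and "\<delta> > 0"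
    and len: "\<And>k t. t \<in> F k \<Longrightarrow> k \<le> length t"
  shows "\<pi>_set (\<Union>k. F k) \<notin> null_ideal"
proof
  assume null: "\<pi>_set (\<Union>k. F k) \<in> null_ideal"
  define U where "U m = (\<Union>k\<in>{m..}. cylinders (F k))" for m
  have U: "U m \<in> sets cantor_measure" for m unfolding U_def by measurable
  have "(\<lambda>m. measure cantor_measure (U m)) \<longlonglongrightarrow> measure cantor_measure (\<Inter>m. U m)"
    by (rule cantor.finite_Lim_measure_decseq) (use U in \<open>force simp: decseq_def U_def\<close>)+
  moreover have "\<delta> \<le> measure cantor_measure (U m)" for m
  proof -
    have "measure cantor_measure (cylinders (F m)) \<le> measure cantor_measure (U m)"
      by (rule cantor.finite_measure_mono) (use U in \<open>auto simp: U_def\<close>)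
    then show ?thesis using meas[of m] by linarith
  qed
  ultimately have pos: "\<delta> \<le> measure cantor_measure (\<Inter>m. U m)"
    by (intro LIMSEQ_le_const) auto
  have sets: "(\<Inter>m. U m) \<in> sets cantor_measure" using U by auto
  have "(\<Inter>m. U m) \<subseteq> \<pi>_set (\<Union>k. F k)"
  proof
    fix y assume y: "y \<in> (\<Inter>m. U m)"
    have "\<exists>n\<ge>m. restr y n \<in> (\<Union>k. F k)" for m
    proof -
      have "y \<in> U m" using y by blast
      then obtain k n where "k \<ge> m" "restr y n \<in> F k" by (auto simp: U_def cylinders_def)
      then show ?thesis using len[of "restr y n" k] by (intro exI[of _ n]) auto
    qed
    then show "y \<in> \<pi>_set (\<Union>k. F k)" by (simp add: \<pi>_set_def INFM_nat_le)
  qed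
  then have "(\<Inter>m. U m) \<in> null_sets (completion cantor_measure)"
    using null null_sets_completion_subset unfolding null_ideal_def by blast
  then have "(\<Inter>m. U m) \<in> null_sets cantor_measure"
    using null_sets_completion_iff[OF sets] by simp
  then have "measure cantor_measure (\<Inter>m. U m) = 0"
    by (auto simp: measure_def)
  then show False using pos \<open>\<delta> > 0\<close> by simp
qed

section \<open>Perfect trees from sets of points\<close>

lemma restr_eq_mono: "restr x m = restr y m \<Longrightarrow> n \<le> m \<Longrightarrow> restr x n = restr y n"
  by (auto simp: restr_eq_iff)

lemma prefix_restr_iff: "prefix s (restr x n) \<longleftrightarrow> (\<exists>m\<le>n. s = restr x m)"
proof
  assume "prefix s (restr x n)"
  then have "s = take (length s) (restr x n)" "length s \<le> n"
    using prefix_length_le[of s "restr x n"] by (auto simp: prefix_def)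
  then show "\<exists>m\<le>n. s = restr x m" by (auto simp: restr_def take_map)
next
  assume "\<exists>m\<le>n. s = restr x m"
  then obtain m where "m \<le> n" "s = restr x m" by blast
  then have "s = take m (restr x n)" by (simp add: restr_def take_map)
  then show "prefix s (restr x n)" by (simp add: take_is_prefix)
qed

text \<open>The splitting hypothesis says that \<open>D\<close> has no isolated points, so its
  closure is perfect, and \<open>D\<close> and its closure have the same initial segments.\<close>

lemma perfect_tree_of_points:
  assumes "D \<noteq> {}" and split: "\<And>x n. x \<in> D \<Longrightarrow> \<exists>x'\<in>D. x' \<noteq> x \<and> restr x' n = restr x n"
  shows "{restr x n | x n. x \<in> D} \<in> perfect_trees" (is "?p \<in> _")
proof -
  have "is_tree ?p"
    unfolding is_tree_def
  proof (intro conjI ballI allI impI)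
    fix t s assume t: "t \<in> ?p" and s: "prefix s t"
    obtain x n where x: "x \<in> D" "t = restr x n" using t by blast
    then obtain m where "s = restr x m" using s by (auto simp: prefix_restr_iff)
    then show "s \<in> ?p" using x by blast
  next
    fix s assume "s \<in> ?p"
    then obtain x n where x: "x \<in> D" "s = restr x n" by auto
    have "strict_prefix s (restr x (Suc n))"
      using length_restr[of x n] length_restr[of x "Suc n"] prefix_restr_iff[of "restr x n" x "Suc n"]
      unfolding x(2) strict_prefix_def by (metis le_SucI n_not_Suc_n order_refl)
    then show "\<exists>t\<in>?p. strict_prefix s t" using x by blast
  qed
  moreover have "\<exists>t\<in>?p. \<exists>u\<in>?p. prefix s t \<and> prefix s u \<and> t \<parallel> u" if s: "s \<in> ?p" for s
  proof -
    obtain x n where x: "x \<in> D" "s = restr x n" using s by auto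
    obtain x' where x': "x' \<in> D" "x' \<noteq> x" "restr x' n = restr x n" using split x by blast
    then obtain j where j: "x' j \<noteq> x j" by blast
    \<comment> \<open>\<open>restr x N\<close> sees only coordinates below \<open>N\<close>, hence
      \<open>Suc j\<close>. Distinct words of equal length are incomparable.\<close>
    define N where "N = max n (Suc j)"
    have ne: "restr x N \<noteq> restr x' N" unfolding restr_eq_iff using j by (intro notI) (auto simp: N_def dest: spec[of _ j])
    then have "restr x N \<parallel> restr x' N"
      by (metis length_restr not_equal_is_parallel)
    moreover have "prefix s (restr x N)" "prefix s (restr x' N)"
      using x x' by (auto simp: prefix_restr_iff N_def intro!: exI[of _ n])
    ultimately show ?thesis using x x' by blast
  qed
  ultimately show ?thesis using assms(1) by (auto simp: perfect_trees_def)
qed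

text \<open>The assumptions collect what \<open>majority_color\<close> and
  \<open>condensation_subset\<close> deliver for the colouring
  \<open>c (restr x (e (restr y n)))\<close>.\<close>

locale condensed_family =
  fixes T :: "(nat \<Rightarrow> bool) set" and H :: "(nat \<Rightarrow> bool) \<Rightarrow> (nat \<Rightarrow> bool) set"
    and c :: "bool list \<Rightarrow> bool" and e :: "bool list \<Rightarrow> nat" and i :: bool
  assumes T_ne: "T \<noteq> {}"
    and H_sets: "x \<in> T \<Longrightarrow> H x \<in> sets cantor_measure"
    and H_large: "x \<in> T \<Longrightarrow> measure cantor_measure (H x) \<ge> 1/2"
    and condensed: "x \<in> T \<Longrightarrow> \<epsilon> > 0 \<Longrightarrow>
      \<exists>x'\<in>T. x' \<noteq> x \<and> restr x' m = restr x m \<and> measure cantor_measure (H x - H x') < \<epsilon>"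
    and limit: "finite Q \<Longrightarrow> Q \<subseteq> T \<Longrightarrow> y \<in> (\<Inter>x\<in>Q. H x) \<Longrightarrow>
      \<exists>\<^sub>\<infinity>n. \<forall>x\<in>Q. c (restr x (e (restr y n))) = i"
begin

text \<open>The invariant of the fusion. The bound 1/4 lies below the initial 1/2, and the strict
  inequality leaves room for a loss at every splitting.\<close>

definition large :: "(nat \<Rightarrow> bool) set \<Rightarrow> bool" where
  "large Q \<longleftrightarrow> finite Q \<and> Q \<noteq> {} \<and> Q \<subseteq> T \<and> measure cantor_measure (\<Inter>x\<in>Q. H x) > 1/4"

text \<open>A finite piece of the positive set to be built: finiteness bounds the levels
  \<open>e t\<close> that must be protected later, and \<open>k \<le> length t\<close> serves
  \<open>not_null_pi_set\<close>.\<close>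

definition witness :: "nat \<Rightarrow> (nat \<Rightarrow> bool) set \<Rightarrow> bool list set \<Rightarrow> bool" where
  "witness k Q F \<longleftrightarrow> finite F \<and> measure cantor_measure (cylinders F) > 1/4 \<and>
     (\<forall>t\<in>F. k \<le> length t \<and> (\<forall>x\<in>Q. c (restr x (e t)) = i))"

lemma sets_INT: "finite Q \<Longrightarrow> Q \<noteq> {} \<Longrightarrow> Q \<subseteq> T \<Longrightarrow> (\<Inter>x\<in>Q. H x) \<in> sets cantor_measure"
  using H_sets by (intro sets.finite_INT) auto

text \<open>By \<open>limit\<close>, each \<open>y\<close> in the intersection has an initial
  segment of length at least \<open>k\<close> that suits all of \<open>Q\<close>. The suitable words
  of bounded length form finite sets \<open>G N\<close>, whose cylinders exhaust a set of measure
  above 1/4.\<close>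

lemma witness_exists:
  assumes "large Q"
  shows "\<exists>F. witness k Q F"
proof -
  have Q: "finite Q" "Q \<noteq> {}" "Q \<subseteq> T" "measure cantor_measure (\<Inter>x\<in>Q. H x) > 1/4"
    using assms by (auto simp: large_def)
  define G where "G N = {t. k \<le> length t \<and> length t \<le> N \<and> (\<forall>x\<in>Q. c (restr x (e t)) = i)}" for N
  have fin: "finite (G N)" for N
    by (rule finite_subset[OF _ finite_lists_length_le[of "UNIV :: bool set" N]]) (auto simp: G_def)
  have "(\<Inter>x\<in>Q. H x) \<subseteq> (\<Union>N. cylinders (G N))"
  proof
    fix y assume "y \<in> (\<Inter>x\<in>Q. H x)"
    then have "\<exists>\<^sub>\<infinity>n. \<forall>x\<in>Q. c (restr x (e (restr y n))) = i" by (rule limit[OF Q(1,3)])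
    then obtain n where "n \<ge> k" "\<forall>x\<in>Q. c (restr x (e (restr y n))) = i"
      unfolding INFM_nat_le by blast
    then have "restr y n \<in> G n" by (simp add: G_def)
    then show "y \<in> (\<Union>N. cylinders (G N))" by (auto simp: cylinders_def)
  qed
  then have "measure cantor_measure (\<Inter>x\<in>Q. H x) \<le> measure cantor_measure (\<Union>N. cylinders (G N))"
    by (intro cantor.finite_measure_mono) auto
  then have "1/4 < measure cantor_measure (\<Union>N. cylinders (G N))" using Q(4) by linarith
  moreover have "(\<lambda>N. measure cantor_measure (cylinders (G N))) \<longlonglongrightarrow>
      measure cantor_measure (\<Union>N. cylinders (G N))"
  proof (rule cantor.finite_Lim_measure_incseq)
    show "range (\<lambda>N. cylinders (G N)) \<subseteq> sets cantor_measure" by auto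
    have "G N \<subseteq> G N'" if "N \<le> N'" for N N' using that by (auto simp: G_def)
    then show "incseq (\<lambda>N. cylinders (G N))" unfolding incseq_def cylinders_def by blast
  qed
  ultimately have "\<forall>\<^sub>F N in sequentially. 1/4 < measure cantor_measure (cylinders (G N))"
    by (rule order_tendstoD(1)[rotated])
  then obtain N where "1/4 < measure cantor_measure (cylinders (G N))"
    by (auto simp: eventually_sequentially)
  then have "witness k Q (G N)" using fin by (auto simp: witness_def G_def)
  then show ?thesis ..
qed

text \<open>Each point receives a condensation twin \<open>g x\<close> that agrees with it below
  \<open>m\<close>; the new intersection loses only points of the small sets
  \<open>H x - H (g x)\<close>.\<close>

lemma large_split:
  assumes "large Q"
  shows "\<exists>Q'. large Q' \<and> Q \<subseteq> Q' \<and> (\<forall>x\<in>Q'. \<exists>x'\<in>Q. restr x m = restr x' m) \<and>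
    (\<forall>x\<in>Q. \<exists>x'\<in>Q'. x' \<noteq> x \<and> restr x' m = restr x m)"
proof -
  have Q: "finite Q" "Q \<noteq> {}" "Q \<subseteq> T" "measure cantor_measure (\<Inter>x\<in>Q. H x) > 1/4"
    using assms by (auto simp: large_def)
  \<comment> \<open>Chosen so that \<open>card Q\<close> losses together use up at most half of the
    excess over 1/4.\<close>
  define \<epsilon> where "\<epsilon> = (measure cantor_measure (\<Inter>x\<in>Q. H x) - 1/4) / (2 * real (card Q))"
  have card: "card Q > 0" using Q by (simp add: card_gt_0_iff)
  then have "\<epsilon> > 0" using Q by (simp add: \<epsilon>_def)
  then have "\<forall>x\<in>Q. \<exists>x'. x' \<in> T \<and> x' \<noteq> x \<and> restr x' m = restr x m \<and> measure cantor_measure (H x - H x') < \<epsilon>"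
    using condensed Q(3) by blast
  then obtain g where g: "\<And>x. x \<in> Q \<Longrightarrow> g x \<in> T" "\<And>x. x \<in> Q \<Longrightarrow> g x \<noteq> x"
      "\<And>x. x \<in> Q \<Longrightarrow> restr (g x) m = restr x m"
      "\<And>x. x \<in> Q \<Longrightarrow> measure cantor_measure (H x - H (g x)) < \<epsilon>"
    by metis
  define Q' where "Q' = Q \<union> g ` Q"
  have Q': "finite Q'" "Q' \<noteq> {}" "Q' \<subseteq> T" using Q g by (auto simp: Q'_def)
  have D: "H x - H (g x) \<in> sets cantor_measure" if "x \<in> Q" for x
    using that Q(3) g(1) H_sets by blast
  have "measure cantor_measure (\<Inter>x\<in>Q. H x)
      \<le> measure cantor_measure ((\<Inter>x\<in>Q'. H x) \<union> (\<Union>x\<in>Q. H x - H (g x)))"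
    using sets_INT[OF Q'] D Q(1)
    by (intro cantor.finite_measure_mono sets.Un sets.finite_UN) (auto simp: Q'_def)
  also have "\<dots> \<le> measure cantor_measure (\<Inter>x\<in>Q'. H x) + measure cantor_measure (\<Union>x\<in>Q. H x - H (g x))"
    using sets_INT[OF Q'] D Q(1) by (intro measure_Un_le sets.finite_UN) auto
  finally have le: "measure cantor_measure (\<Inter>x\<in>Q. H x)
      \<le> measure cantor_measure (\<Inter>x\<in>Q'. H x) + measure cantor_measure (\<Union>x\<in>Q. H x - H (g x))" .
  have "measure cantor_measure (\<Union>x\<in>Q. H x - H (g x)) \<le> (\<Sum>x\<in>Q. measure cantor_measure (H x - H (g x)))"
    by (rule measure_UNION_le[OF Q(1) D])
  also have "\<dots> \<le> real (card Q) * \<epsilon>"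
    using g(4) by (intro sum_bounded_above) (auto intro: less_imp_le)
  also have "\<dots> = (measure cantor_measure (\<Inter>x\<in>Q. H x) - 1/4) / 2"
    using card by (simp add: \<epsilon>_def)
  finally have "measure cantor_measure (\<Inter>x\<in>Q'. H x) > 1/4" using le Q(4) by argo
  then have "large Q'" using Q' by (simp add: large_def)
  moreover have "\<forall>x\<in>Q'. \<exists>x'\<in>Q. restr x m = restr x' m" using g(3) by (auto simp: Q'_def)
  moreover have "\<forall>x\<in>Q. \<exists>x'\<in>Q'. x' \<noteq> x \<and> restr x' m = restr x m" using g(2,3) by (auto simp: Q'_def)
  ultimately show ?thesis by (intro exI[of _ Q']) (auto simp: Q'_def)
qed

text \<open>Stage \<open>k\<close> has a finite set \<open>Q k\<close> of points, a witness
  \<open>F k\<close> and a level \<open>m k\<close> bounding \<open>e t\<close> for \<open>t\<close>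
  in \<open>F k\<close>. Later stages add no new initial segment of length at most
  \<open>m k\<close>, so the colours secured by \<open>F k\<close> persist. The tree comes from the
  union of the \<open>Q k\<close>, and \<open>a\<close> is the union of the
  \<open>F k\<close>.\<close>

lemma fusion:
  "\<exists>p\<in>perfect_trees. \<exists>a. \<pi>_set a \<notin> null_ideal \<and> (\<forall>s\<in>p. length s \<in> e ` a \<longrightarrow> c s = i)"
proof -
  \<comment> \<open>Here \<open>z\<close> is the triple of points, witness and protected level; the
    last conjunct sends the protected levels to infinity.\<close>
  define P where "P k z \<longleftrightarrow> large (fst z) \<and> witness k (fst z) (fst (snd z)) \<and>
      (\<forall>t\<in>fst (snd z). e t \<le> snd (snd z)) \<and> k \<le> snd (snd z)"
    for k and z :: "(nat \<Rightarrow> bool) set \<times> bool list set \<times> nat"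
  \<comment> \<open>The third conjunct keeps the tree unchanged up to the protected level, the
    fourth splits every old point beyond it.\<close>
  define R where "R z z' \<longleftrightarrow> fst z \<subseteq> fst z' \<and> snd (snd z) \<le> snd (snd z') \<and>
      (\<forall>x\<in>fst z'. \<exists>x'\<in>fst z. restr x (snd (snd z)) = restr x' (snd (snd z))) \<and>
      (\<forall>x\<in>fst z. \<exists>x'\<in>fst z'. x' \<noteq> x \<and> restr x' (snd (snd z)) = restr x (snd (snd z)))"
    for z z' :: "(nat \<Rightarrow> bool) set \<times> bool list set \<times> nat"
  have extend: "\<exists>F m. P k (Q, F, m) \<and> m0 \<le> m" if Q: "large Q" for k Q m0
  proof -
    obtain F where F: "witness k Q F" using witness_exists[OF Q] by blast
    define m where "m = Max (insert k (insert m0 (e ` F)))"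
    have "finite F" using F by (simp add: witness_def)
    then have "\<forall>t\<in>F. e t \<le> m" "k \<le> m" "m0 \<le> m"
      unfolding m_def by (auto intro!: Max_ge simp del: Max_insert)
    then show ?thesis using Q F by (auto simp: P_def)
  qed
  have "\<exists>z. \<forall>k. P k (z k) \<and> R (z k) (z (Suc k))"
  proof (rule dependent_nat_choice)
    obtain x where x: "x \<in> T" using T_ne by blast
    \<comment> \<open>A single point starts the construction, since 1/2 exceeds 1/4.\<close>
    then have "large {x}" using H_large[OF x] by (auto simp: large_def)
    then show "\<exists>z. P 0 z" using extend by blast
  next
    fix z k assume z: "P k z"
    then have "large (fst z)" by (simp add: P_def)
    from large_split[OF this, of "snd (snd z)"] obtain Q' where Q': "large Q'" "fst z \<subseteq> Q'"
        "\<forall>x\<in>Q'. \<exists>x'\<in>fst z. restr x (snd (snd z)) = restr x' (snd (snd z))"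
        "\<forall>x\<in>fst z. \<exists>x'\<in>Q'. x' \<noteq> x \<and> restr x' (snd (snd z)) = restr x (snd (snd z))"
      by (elim exE conjE)
    obtain F m where "P (Suc k) (Q', F, m)" "snd (snd z) \<le> m" using extend[OF Q'(1)] by blast
    then show "\<exists>z'. P (Suc k) z' \<and> R z z'"
      using Q' by (intro exI[of _ "(Q', F, m)"]) (auto simp: R_def)
  qed
  then obtain z where z: "\<And>k. P k (z k)" "\<And>k. R (z k) (z (Suc k))" by blast
  define Q where "Q k = fst (z k)" for k
  define F where "F k = fst (snd (z k))" for k
  define m where "m k = snd (snd (z k))" for k
  have P: "Q k \<noteq> {}" "witness k (Q k) (F k)" "\<And>t. t \<in> F k \<Longrightarrow> e t \<le> m k" "k \<le> m k" for k
    using z(1)[of k] by (auto simp: P_def Q_def F_def m_def large_def)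
  have Rk: "Q k \<subseteq> Q (Suc k)" "m k \<le> m (Suc k)"
      "\<And>x. x \<in> Q (Suc k) \<Longrightarrow> \<exists>x'\<in>Q k. restr x (m k) = restr x' (m k)"
      "\<And>x. x \<in> Q k \<Longrightarrow> \<exists>x'\<in>Q (Suc k). x' \<noteq> x \<and> restr x' (m k) = restr x (m k)" for k
    using z(2)[of k] by (auto simp: R_def Q_def m_def)
  have Qmono: "Q k \<subseteq> Q l" if "k \<le> l" for k l
    using lift_Suc_mono_le[of Q, OF Rk(1) that] .
  have mmono: "m k \<le> m l" if "k \<le> l" for k l
    using lift_Suc_mono_le[of m, OF Rk(2) that] .
  have agree: "\<exists>x'\<in>Q k. restr x (m k) = restr x' (m k)" if "x \<in> Q (k + l)" for x k l
    using that
  proof (induction l arbitrary: x)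
    case 0
    then show ?case by auto
  next
    case (Suc l)
    then obtain x1 where x1: "x1 \<in> Q (k + l)" "restr x (m (k + l)) = restr x1 (m (k + l))"
      using Rk(3)[of x "k + l"] by auto
    then have "restr x (m k) = restr x1 (m k)"
      using mmono[of k "k + l"] by (intro restr_eq_mono[OF x1(2)]) simp
    then show ?case using Suc.IH[OF x1(1)] by auto
  qed
  define D where "D = (\<Union>k. Q k)"
  have "{restr x n | x n. x \<in> D} \<in> perfect_trees"
  proof (rule perfect_tree_of_points)
    show "D \<noteq> {}" using P(1) by (auto simp: D_def)
  next
    fix x n assume "x \<in> D"
    then obtain k where "x \<in> Q k" by (auto simp: D_def)
    \<comment> \<open>This stage contains \<open>x\<close> and protects level \<open>n\<close>, so
      the twin added next agrees with \<open>x\<close> below \<open>n\<close>.\<close>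
    then have "x \<in> Q (max k n)" using Qmono[of k "max k n"] by auto
    then obtain x' where x': "x' \<in> Q (Suc (max k n))" "x' \<noteq> x" "restr x' (m (max k n)) = restr x (m (max k n))"
      using Rk(4) by blast
    moreover have "n \<le> m (max k n)" using P(4)[of "max k n"] by linarith
    ultimately show "\<exists>x'\<in>D. x' \<noteq> x \<and> restr x' n = restr x n"
      using restr_eq_mono[OF x'(3)] by (auto simp: D_def)
  qed
  moreover have "\<pi>_set (\<Union>k. F k) \<notin> null_ideal"
    by (rule not_null_pi_set[where \<delta> = "1/4"]) (use P(2) in \<open>auto simp: witness_def\<close>)
  moreover have "c s = i" if s: "s \<in> {restr x n | x n. x \<in> D}" and len: "length s \<in> e ` (\<Union>k. F k)" for s
  proof -
    obtain x n l where x: "s = restr x n" "x \<in> Q l" using s by (auto simp: D_def)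
    obtain k t where t: "t \<in> F k" "n = e t" using len x by auto
    \<comment> \<open>Whatever stage \<open>x\<close> came from, at level \<open>e t\<close> it
      looks like some point of \<open>Q k\<close>, whose colour there is fixed by the witness
      \<open>F k\<close>.\<close>
    have "x \<in> Q (k + l)" using x Qmono[of l "k + l"] by auto
    then obtain x' where x': "x' \<in> Q k" "restr x (m k) = restr x' (m k)" using agree by blast
    then have "s = restr x' (e t)" using restr_eq_mono[OF x'(2) P(3)[OF t(1)]] x t by simp
    then show ?thesis using P(2)[of k] t x' by (auto simp: witness_def)
  qed
  ultimately show ?thesis by blast
qed

end

section \<open>The trace ideal\<close>

lemma uncountable_cantor_space: "uncountable (UNIV :: (nat \<Rightarrow> bool) set)"
proof
  assume "countable (UNIV :: (nat \<Rightarrow> bool) set)"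
  then obtain f :: "nat \<Rightarrow> nat \<Rightarrow> bool" where f: "range f = UNIV"
    by (metis UNIV_not_empty uncountable_def)
  obtain n where "f n = (\<lambda>k. \<not> f k k)" using f by (metis rangeE UNIV_I)
  then show False by metis
qed

lemma is_ideal_trace_null: "is_ideal (trace_ideal null_ideal)"
  unfolding is_ideal_def
proof (intro conjI allI impI)
  have "\<pi>_set UNIV = space cantor_measure" by (auto simp: \<pi>_set_def)
  moreover have "space cantor_measure \<notin> null_sets (completion cantor_measure)"
    using null_sets_completion_iff[OF sets.top[of cantor_measure]] cantor.emeasure_space_1
    by (auto simp: null_sets_def)
  ultimately show "UNIV \<notin> trace_ideal null_ideal"
    by (simp add: trace_ideal_def null_ideal_def)
next
  fix A :: "bool list set" assume A: "finite A"
  have "x \<notin> \<pi>_set A" for x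
  proof
    assume "x \<in> \<pi>_set A"
    then have "infinite {n. restr x n \<in> A}" by (simp add: \<pi>_set_def INFM_iff_infinite)
    \<comment> \<open>A finite set of words has only finitely many lengths.\<close>
    moreover have "{n. restr x n \<in> A} \<subseteq> length ` A" by force
    ultimately show False using A finite_subset by blast
  qed
  then have "\<pi>_set A = {}" by blast
  then show "A \<in> trace_ideal null_ideal" by (simp add: trace_ideal_def null_ideal_def)
next
  fix A B :: "bool list set" assume A: "A \<in> trace_ideal null_ideal" and "B \<subseteq> A"
  then have "\<pi>_set B \<subseteq> \<pi>_set A" unfolding \<pi>_set_def by (auto elim: INFM_mono)
  then show "B \<in> trace_ideal null_ideal"
    using A null_sets_completion_subset by (auto simp: trace_ideal_def null_ideal_def)
next
  fix A B :: "bool list set" assume "A \<in> trace_ideal null_ideal" "B \<in> trace_ideal null_ideal"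
  moreover have "\<pi>_set (A \<union> B) = \<pi>_set A \<union> \<pi>_set B"
    by (auto simp: \<pi>_set_def INFM_disj_distrib)
  ultimately show "A \<union> B \<in> trace_ideal null_ideal"
    by (simp add: trace_ideal_def null_ideal_def null_sets.Un)
qed

text \<open>For fixed \<open>n\<close> and \<open>x\<close> the colour
  \<open>c (restr x (e (restr y n)))\<close> depends on \<open>y\<close> only through
  \<open>restr y n\<close>, so it is measurable in \<open>y\<close> and the preceding results
  apply.\<close>

lemma HL_on_nat_trace_null:
  assumes e: "bij (e :: bool list \<Rightarrow> nat)"
  shows "HL_on_nat ((\<lambda>A. e ` A) ` trace_ideal null_ideal)"
  unfolding HL_on_nat_def
proof
  fix c :: "bool list \<Rightarrow> bool"
  obtain S :: "(nat \<Rightarrow> bool) set" and H i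
    where S: "uncountable S" "\<And>x. x \<in> S \<Longrightarrow> H x \<in> sets cantor_measure"
      "\<And>x. x \<in> S \<Longrightarrow> measure cantor_measure (H x) \<ge> 1/2"
      "\<And>F y. finite F \<Longrightarrow> F \<subseteq> S \<Longrightarrow> y \<in> (\<Inter>x\<in>F. H x) \<Longrightarrow>
        \<exists>\<^sub>\<infinity>n. \<forall>x\<in>F. c (restr x (e (restr y n))) = i"
    by (rule majority_color[where b = "\<lambda>n x y. c (restr x (e (restr y n)))",
      OF pred_restr uncountable_cantor_space]) (rule that)
  obtain T where T: "T \<subseteq> S" "T \<noteq> {}"
    "\<And>x m \<epsilon>. x \<in> T \<Longrightarrow> \<epsilon> > 0 \<Longrightarrow>
      \<exists>x'\<in>T. x' \<noteq> x \<and> restr x' m = restr x m \<and> measure cantor_measure (H x - H x') < \<epsilon>"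
    by (rule condensation_subset[of S H, OF S(1,2)]) (assumption | rule that)+
  interpret condensed_family T H c e i
  proof
    show "T \<noteq> {}" by (rule T(2))
    show "H x \<in> sets cantor_measure" "1/2 \<le> measure cantor_measure (H x)" if "x \<in> T" for x
      using S(2,3) T(1) that by blast+
    show "\<exists>x'\<in>T. x' \<noteq> x \<and> restr x' m = restr x m \<and> measure cantor_measure (H x - H x') < \<epsilon>"
      if "x \<in> T" "0 < \<epsilon>" for x m \<epsilon>
      using T(3) that by blast
    show "\<exists>\<^sub>\<infinity>n. \<forall>x\<in>Q. c (restr x (e (restr y n))) = i"
      if "finite Q" "Q \<subseteq> T" "y \<in> (\<Inter>x\<in>Q. H x)" for Q y
      using S(4)[OF that(1) _ that(3)] that(2) T(1) by blast
  qed
  obtain p a where p: "p \<in> perfect_trees" and a: "\<pi>_set a \<notin> null_ideal"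
    and const: "\<forall>s\<in>p. length s \<in> e ` a \<longrightarrow> c s = i"
    using fusion by blast
  \<comment> \<open>By injectivity of \<open>e\<close>, the image of \<open>a\<close> lies in the
    transferred ideal only if \<open>a\<close> lies in the trace ideal.\<close>
  have "e ` a \<in> positive_sets ((\<lambda>A. e ` A) ` trace_ideal null_ideal)"
    using a inj_image_eq_iff[OF bij_is_inj[OF e]]
    by (auto simp: positive_sets_def trace_ideal_def)
  then show "\<exists>p\<in>perfect_trees. \<exists>A\<in>positive_sets ((\<lambda>A. e ` A) ` trace_ideal null_ideal).
      \<exists>i. \<forall>s\<in>level_restr p A. c s = i"
    using p const by (intro bexI[of _ p] bexI[of _ "e ` a"] exI[of _ i]) (auto simp: level_restr_def)
qed

theorem theorem3p15: "HL_ideal (trace_ideal null_ideal)"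
proof -
  have "infinite (UNIV :: bool list set)" by (rule infinite_UNIV_listI)
  then obtain e :: "bool list \<Rightarrow> nat" where "bij e"
    by (metis countableE_infinite countableI_type)
  then show ?thesis
    unfolding HL_ideal_def using is_ideal_trace_null HL_on_nat_trace_null by blast
qed

end
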